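(* For every finite nonempty subset $C \subset \mathbb N_{\ge 2}$ there is a finitely generated commutative Krull monoid $H$ with finite class group such that $\mathsf{Ta}(H) = C$.
   Context: Monoids are cancellative with identity. For a commutative monoid $H$, $H^{\times}$ is the unit group, $H_{\mathrm{red}} = H/H^{\times}$, $\mathsf q(\cdot)$ denotes quotient groups, and $\mathcal A(\cdot)$ the set of atoms (irreducible elements). For a set $P$, $\mathcal F(P)$ is the free abelian monoid with basis $P$. Krull monoids: a homomorphism $\varphi \colon H \to F=\mathcal F(P)$ is a divisor theory if $\varphi(a) \mid \varphi(b)$ implies $a \mid b$ for all $a,b\in H$, and every $\alpha \in F$ is of the form $\gcd(\varphi(a_1), \dots, \varphi(a_m))$ with $a_1, \dots, a_m \in H$. A commutative monoid $H$ is a Krull monoid if it has a divisor theory; then there is a free abelian monoid $F$ such that the inclusion $H_{\mathrm{red}} \hookrightarrow F$ is a divisor theory, and the class group of $H$ is $\mathsf q(F)/\mathsf q(H_{\mathrm{red}})$. Tame degrees: let $H$ be a commutative atomic monoid in which every element has only finitely many factorization lengths (this holds for Krull monoids). $\mathsf Z(H) = \mathcal F(\mathcal A(H_{\mathrm{red}}))$ is the factorization monoid, $\pi \colon \mathsf Z(H) \to H_{\mathrm{red}}$ the canonical homomorphism, $\mathsf Z(a) = \pi^{-1}(aH^{\times})$. For $z, z' \in \mathsf Z(H)$ write $z = xy$, $z' = xy'$ with $x = \gcd(z,z')$ in $\mathsf Z(H)$; then $\mathsf d(z,z') = \max\{|y|, |y'|\}$, where $|\cdot|$ is the length in the free abelian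 monoid. For $a \in H$ and $u \in \mathcal A(H_{\mathrm{red}})$, the tame degree $\mathsf t(a,u)$ is the smallest $N \in \mathbb N_0\cup\{\infty\}$ such that: if $\mathsf Z(a) \cap u\mathsf Z(H) \ne \emptyset$ and $z \in \mathsf Z(a)$, then there is $z' \in \mathsf Z(a) \cap u\mathsf Z(H)$ with $\mathsf d(z,z') \le N$ (so $\mathsf t(a,u) = 0$ if $\mathsf Z(a) \cap u\mathsf Z(H) = \emptyset$). Then $\mathsf{Ta}(H) = \{\mathsf t(a,u) \mid a \in H,\ u \in \mathcal A(H_{\mathrm{red}}),\ \mathsf t(a,u) > 0\}$. *)

theory Defs
  imports "HOL-Algebra.Divisibility" "HOL-Algebra.FiniteProduct" "HOL-Library.Multiset" "HOL-Library.Extended_Nat"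
begin

definition free_abelian_monoid :: "'p set \<Rightarrow> 'p multiset monoid" where
  "free_abelian_monoid P = \<lparr>carrier = {M. set_mset M \<subseteq> P}, monoid.mult = (+), one = {#}\<rparr>"

definition reduced_monoid :: "('a, 'm) monoid_scheme \<Rightarrow> 'a set monoid" where
  "reduced_monoid H =
     \<lparr>carrier = (\<lambda>a. a <#\<^bsub>H\<^esub> Units H) ` carrier H, monoid.mult = set_mult H, one = Units H\<rparr>"

definition atoms :: "('a, 'm) monoid_scheme \<Rightarrow> 'a set" where
  "atoms H = {u \<in> carrier H. irreducible H u}"

definition finitely_generated_monoid :: "('a, 'm) monoid_scheme \<Rightarrow> bool" where
  "finitely_generated_monoid H \<longleftrightarrow>
     (\<exists>S \<subseteq> carrier H. finite S \<and> carrier H = \<Inter> {M. submonoid M H \<and> S \<subseteq> M})"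

definition fraction_rel :: "('a, 'm) monoid_scheme \<Rightarrow> (('a \<times> 'a) \<times> ('a \<times> 'a)) set" where
  "fraction_rel H =
     {((a, b), (c, d)). a \<in> carrier H \<and> b \<in> carrier H \<and> c \<in> carrier H \<and> d \<in> carrier H \<and>
                        a \<otimes>\<^bsub>H\<^esub> d = c \<otimes>\<^bsub>H\<^esub> b}"

text \<open>The class of \<open>(a, b)\<close> is the fraction \<open>a b\<^sup>-\<^sup>1\<close>.\<close>

definition fraction :: "('a, 'm) monoid_scheme \<Rightarrow> 'a \<Rightarrow> 'a \<Rightarrow> ('a \<times> 'a) set" where
  "fraction H a b = fraction_rel H `` {(a, b)}"

definition quotient_group :: "('a, 'm) monoid_scheme \<Rightarrow> ('a \<times> 'a) set monoid" where
  "quotient_group H =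
     \<lparr>carrier = (carrier H \<times> carrier H) // fraction_rel H,
      monoid.mult = (\<lambda>X Y. \<Union>(a, b) \<in> X. \<Union>(c, d) \<in> Y. fraction H (a \<otimes>\<^bsub>H\<^esub> c) (b \<otimes>\<^bsub>H\<^esub> d)),
      one = fraction H \<one>\<^bsub>H\<^esub> \<one>\<^bsub>H\<^esub>\<rparr>"

definition is_gcd_of_set :: "('a, 'm) monoid_scheme \<Rightarrow> 'a \<Rightarrow> 'a set \<Rightarrow> bool" where
  "is_gcd_of_set G d A \<longleftrightarrow>
     d \<in> carrier G \<and> (\<forall>a\<in>A. d divides\<^bsub>G\<^esub> a) \<and>
     (\<forall>c\<in>carrier G. (\<forall>a\<in>A. c divides\<^bsub>G\<^esub> a) \<longrightarrow> c divides\<^bsub>G\<^esub> d)"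

text \<open>
  A homomorphism into a cancellative monoid preserves the identity, so \<^const>\<open>hom\<close>
  suffices. Gcds in a free abelian monoid are unique, since its only unit is the identity.
\<close>

definition divisor_theory ::
    "('a, 'm) monoid_scheme \<Rightarrow> 'p set \<Rightarrow> ('a \<Rightarrow> 'p multiset) \<Rightarrow> bool" where
  "divisor_theory H P \<phi> \<longleftrightarrow>
     \<phi> \<in> hom H (free_abelian_monoid P) \<and>
     (\<forall>a\<in>carrier H. \<forall>b\<in>carrier H.
        \<phi> a divides\<^bsub>free_abelian_monoid P\<^esub> \<phi> b \<longrightarrow> a divides\<^bsub>H\<^esub> b) \<and>
     (\<forall>\<alpha>\<in>carrier (free_abelian_monoid P). \<exists>A \<subseteq> carrier H.
        finite A \<and> A \<noteq> {} \<and> is_gcd_of_set (free_abelian_monoid P) \<alpha> (\<phi> ` A))"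

text \<open>
  Each prime in a divisor theory of \<open>H\<close> is the gcd of the image of a finite subset of \<open>H\<close>,
  and is determined by that subset. Hence the primes can be taken to be of type
  \<open>'a set\<close> without loss of generality.
\<close>

definition krull_monoid :: "('a, 'm) monoid_scheme \<Rightarrow> bool" where
  "krull_monoid H \<longleftrightarrow>
     comm_monoid_cancel H \<and>
     (\<exists>(P :: 'a set set) (\<phi> :: 'a \<Rightarrow> 'a set multiset). divisor_theory H P \<phi>)"

text \<open>
  For a divisor theory \<open>\<iota>\<close> of \<open>reduced_monoid H\<close>, which is injective, the subgroup
  below is the quotient group of \<open>reduced_monoid H\<close> inside that of the free abelian monoid.
\<close>

definition class_group ::
    "('a, 'm) monoid_scheme \<Rightarrow> 'p set \<Rightarrow> ('a set \<Rightarrow> 'p multiset) \<Rightarrow> ('p multiset \<times> 'p multiset) set set monoid"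
  where
  "class_group H P \<iota> =
     quotient_group (free_abelian_monoid P) Mod
       {fraction (free_abelian_monoid P) (\<iota> a) (\<iota> b) | a b.
          a \<in> carrier (reduced_monoid H) \<and> b \<in> carrier (reduced_monoid H)}"

text \<open>
  Divisor theories are unique up to isomorphism, so the finiteness of the class group does
  not depend on the choice of \<open>P\<close> and \<open>\<iota>\<close>.
\<close>

definition has_finite_class_group :: "('a, 'm) monoid_scheme \<Rightarrow> bool" where
  "has_finite_class_group H \<longleftrightarrow>
     (\<exists>(P :: 'a set set) (\<iota> :: 'a set \<Rightarrow> 'a set multiset).
        divisor_theory (reduced_monoid H) P \<iota> \<and> finite (carrier (class_group H P \<iota>)))"

definition factorization_monoid :: "('a, 'm) monoid_scheme \<Rightarrow> 'a set multiset monoid" where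
  "factorization_monoid H = free_abelian_monoid (atoms (reduced_monoid H))"

definition factorization_hom :: "('a, 'm) monoid_scheme \<Rightarrow> 'a set multiset \<Rightarrow> 'a set" where
  "factorization_hom H z =
     finprod (reduced_monoid H) (\<lambda>u. u [^]\<^bsub>reduced_monoid H\<^esub> count z u) (set_mset z)"

definition factorizations :: "('a, 'm) monoid_scheme \<Rightarrow> 'a \<Rightarrow> 'a set multiset set" where
  "factorizations H a =
     {z \<in> carrier (factorization_monoid H). factorization_hom H z = a <#\<^bsub>H\<^esub> Units H}"

text \<open>The multiset intersection is the gcd in the free abelian monoid.\<close>

definition factorization_dist :: "'b multiset \<Rightarrow> 'b multiset \<Rightarrow> nat" where
  "factorization_dist z z' = max (size (z - z \<inter># z')) (size (z' - z \<inter># z'))"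

definition factorizations_with :: "('a, 'm) monoid_scheme \<Rightarrow> 'a \<Rightarrow> 'a set \<Rightarrow> 'a set multiset set" where
  "factorizations_with H a u =
     factorizations H a \<inter> add_mset u ` carrier (factorization_monoid H)"

definition tame_degree :: "('a, 'm) monoid_scheme \<Rightarrow> 'a \<Rightarrow> 'a set \<Rightarrow> enat" where
  "tame_degree H a u = (LEAST N.
     factorizations_with H a u \<noteq> {} \<longrightarrow>
     (\<forall>z\<in>factorizations H a. \<exists>z'\<in>factorizations_with H a u.
        enat (factorization_dist z z') \<le> N))"

definition tame_degrees :: "('a, 'm) monoid_scheme \<Rightarrow> enat set" where
  "tame_degrees H =
     {tame_degree H a u | a u.
        a \<in> carrier H \<and> u \<in> atoms (reduced_monoid H) \<and> tame_degree H a u > 0}"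

end

theory Submission
  imports Defs
begin

text \<open>
  For one number \<open>n \<ge> 2\<close> take two primes \<open>p\<close>, \<open>q\<close> and the monoid of all products
  \<open>p\<^sup>i q\<^sup>j\<close> with \<open>i \<equiv> j\<close> modulo \<open>n\<close>. For \<open>n \<ge> 3\<close> it is isomorphic to the monoid of zero-sum
  sequences over \<open>{g, -g}\<close>, where \<open>g\<close> generates the cyclic group of order \<open>n\<close>. Its atoms are \<open>A = p\<^sup>n\<close>, \<open>B = q\<^sup>n\<close>
  and \<open>W = p q\<close>, and every relation between them is a consequence of \<open>A B = W\<^sup>n\<close>. If a
  factorization does not contain a given atom while another factorization of the same
  element does, then comparing exponents of \<open>p\<close> and \<open>q\<close> shows that the two differ in at
  least \<open>n\<close> copies of \<open>W\<close>, and that one application of the relation brings the atom in.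
  So all positive tame degrees equal \<open>n\<close>.

  For a set \<open>C\<close> of numbers take the coproduct of these monoids over \<open>n \<in> C\<close>, realised as a
  set \<open>balanced C\<close> of multisets with the primes \<open>2 n\<close> and \<open>2 n + 1\<close> for each \<open>n\<close>. The atoms
  belonging to different \<open>n\<close> do not interact, so the positive tame degrees are the
  elements of \<open>C\<close> (\<open>exchange_step\<close>, \<open>tame_degrees_balanced\<close>).

  The inclusion into the free abelian monoid is a divisor theory: the congruences are
  preserved under subtraction, and any multiset can be completed to a balanced one either
  by adding only odd primes or by adding only even primes, which makes it the gcd of the two
  completions (\<open>balanced_gcd\<close>). The class group is finite because the product of \<open>C\<close>
  annihilates it (\<open>finite_class_group\<close>).
\<close>

section \<open>Submonoids of free abelian monoids\<close>

definition multiset_monoid :: "'a multiset set \<Rightarrow> 'a multiset monoid" where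
  "multiset_monoid K = \<lparr>carrier = K, monoid.mult = (+), one = {#}\<rparr>"

lemma multiset_monoid_simps [simp]:
  "carrier (multiset_monoid K) = K"
  "x \<otimes>\<^bsub>multiset_monoid K\<^esub> y = x + y"
  "\<one>\<^bsub>multiset_monoid K\<^esub> = {#}"
  by (simp_all add: multiset_monoid_def)

lemma free_abelian_monoid_eq: "free_abelian_monoid P = multiset_monoid {M. set_mset M \<subseteq> P}"
  by (simp add: free_abelian_monoid_def multiset_monoid_def)

lemma divides_free_abelian_monoid:
  assumes "set_mset b \<subseteq> P"
  shows "a divides\<^bsub>free_abelian_monoid P\<^esub> b \<longleftrightarrow> a \<subseteq># b"
proof
  assume "a \<subseteq># b"
  then have "b = a + (b - a)" "set_mset (b - a) \<subseteq> P"
    using assms by (auto dest: in_diffD)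
  then show "a divides\<^bsub>free_abelian_monoid P\<^esub> b"
    unfolding factor_def free_abelian_monoid_eq by auto
qed (auto simp: factor_def free_abelian_monoid_eq)

text \<open>
  \<^const>\<open>factorization_hom\<close> takes one power for each distinct atom. The sum over all entries
  is better suited to induction on the multiset.
\<close>

lemma sum_mset_image_eq_sum_repeat_mset:
  fixes f :: "'b \<Rightarrow> 'c multiset"
  shows "(\<Sum>x\<in>#z. f x) = (\<Sum>u\<in>set_mset z. repeat_mset (count z u) (f u))"
proof (induction z)
  case (add x z)
  have "(\<Sum>u\<in>set_mset (add_mset x z). repeat_mset (count (add_mset x z) u) (f u)) =
      (\<Sum>u\<in>insert x (set_mset z). repeat_mset (count z u) (f u) + (if u = x then f x else {#}))"
    by (intro sum.cong) auto
  also have "\<dots> = (\<Sum>u\<in>insert x (set_mset z). repeat_mset (count z u) (f u)) + f x"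
    by (simp add: sum.distrib)
  also have "(\<Sum>u\<in>insert x (set_mset z). repeat_mset (count z u) (f u)) =
      (\<Sum>u\<in>set_mset z. repeat_mset (count z u) (f u))"
    by (intro sum.mono_neutral_right) (auto simp: not_in_iff)
  finally show ?case
    using add by (simp add: ac_simps)
qed simp

locale multiset_submonoid =
  fixes K :: "'a multiset set"
  assumes empty_mem: "{#} \<in> K"
    and add_mem: "a \<in> K \<Longrightarrow> b \<in> K \<Longrightarrow> a + b \<in> K"
begin

lemma comm_monoid_cancel: "comm_monoid_cancel (multiset_monoid K)"
  by unfold_locales (auto simp: empty_mem add_mem ac_simps Units_def)

lemma Units_eq: "Units (multiset_monoid K) = {{#}}"
  by (auto simp: Units_def empty_mem)

text \<open>
  As the only unit is the empty multiset, passing to the reduced monoid merely replaces every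
  element by its singleton.
\<close>

lemma l_coset_Units: "a <#\<^bsub>multiset_monoid K\<^esub> Units (multiset_monoid K) = {a}"
  by (simp add: Units_eq l_coset_def)

lemma reduced_simps:
  "carrier (reduced_monoid (multiset_monoid K)) = (\<lambda>a. {a}) ` K"
  "\<one>\<^bsub>reduced_monoid (multiset_monoid K)\<^esub> = {{#}}"
  by (simp_all add: reduced_monoid_def l_coset_def Units_eq)

lemma reduced_mult:
  "X \<otimes>\<^bsub>reduced_monoid (multiset_monoid K)\<^esub> Y = (\<Union>x\<in>X. \<Union>y\<in>Y. {x + y})"
  by (simp add: reduced_monoid_def set_mult_def)

lemma comm_monoid_reduced: "comm_monoid (reduced_monoid (multiset_monoid K))"
proof (rule comm_monoidI; (unfold reduced_simps)?; (elim imageE)?)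
  show "{{#}} \<in> (\<lambda>a. {a}) ` K"
    using empty_mem by simp
qed (simp_all add: reduced_mult add_mem ac_simps)

lemma reduced_pow:
  "{a} [^]\<^bsub>reduced_monoid (multiset_monoid K)\<^esub> (n::nat) = {repeat_mset n a}"
  by (induction n) (simp_all add: reduced_simps reduced_mult nat_pow_def ac_simps)

lemma repeat_mem: "a \<in> K \<Longrightarrow> repeat_mset n a \<in> K"
  by (induction n) (auto simp: empty_mem add_mem)

lemma divides_reduced:
  "{a} divides\<^bsub>reduced_monoid (multiset_monoid K)\<^esub> {b} \<longleftrightarrow> (\<exists>c\<in>K. b = a + c)"
  by (auto simp: factor_def reduced_simps reduced_mult)

lemma Units_reduced: "Units (reduced_monoid (multiset_monoid K)) = {{{#}}}"
  by (auto simp: Units_def reduced_simps reduced_mult empty_mem)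

lemma atoms_reduced:
  "atoms (reduced_monoid (multiset_monoid K)) =
     (\<lambda>u. {u}) ` {u \<in> K - {{#}}. \<forall>b\<in>K. \<forall>c\<in>K. u = b + c \<longrightarrow> b = {#} \<or> c = {#}}"
proof -
  have *: "properfactor (reduced_monoid (multiset_monoid K)) {b} {u} \<longleftrightarrow>
      (\<exists>c\<in>K. u = b + c \<and> c \<noteq> {#})" for b u
    by (auto simp: properfactor_def divides_reduced empty_mem add.assoc)
  have "{u} \<in> atoms (reduced_monoid (multiset_monoid K)) \<longleftrightarrow>
      u \<in> K - {{#}} \<and> (\<forall>b\<in>K. \<forall>c\<in>K. u = b + c \<longrightarrow> b = {#} \<or> c = {#})" for u
    unfolding atoms_def irreducible_def mem_Collect_eq Units_reduced reduced_simps ball_simps *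
    by (simp add: inj_image_mem_iff) blast
  then have atom_iff: "{u} \<in> atoms (reduced_monoid (multiset_monoid K)) \<longleftrightarrow>
      u \<in> {u \<in> K - {{#}}. \<forall>b\<in>K. \<forall>c\<in>K. u = b + c \<longrightarrow> b = {#} \<or> c = {#}}" for u
    by (simp only: mem_Collect_eq)
  have singleton: "x \<in> (\<lambda>u. {u}) ` K" if "x \<in> atoms (reduced_monoid (multiset_monoid K))" for x
    using that by (simp add: atoms_def reduced_simps)
  show ?thesis
  proof (intro equalityI subsetI)
    fix x
    assume x: "x \<in> atoms (reduced_monoid (multiset_monoid K))"
    from singleton[OF x] obtain u where "x = {u}" ..
    with x show "x \<in> (\<lambda>u. {u}) ` {u \<in> K - {{#}}. \<forall>b\<in>K. \<forall>c\<in>K. u = b + c \<longrightarrow> b = {#} \<or> c = {#}}"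
      by (simp only: atom_iff) (rule imageI)
  next
    fix x
    assume "x \<in> (\<lambda>u. {u}) ` {u \<in> K - {{#}}. \<forall>b\<in>K. \<forall>c\<in>K. u = b + c \<longrightarrow> b = {#} \<or> c = {#}}"
    then show "x \<in> atoms (reduced_monoid (multiset_monoid K))"
      by (elim imageE) (simp only: atom_iff)
  qed
qed

lemma factorization_hom_eq:
  assumes "set_mset z \<subseteq> (\<lambda>a. {a}) ` K"
  shows "factorization_hom (multiset_monoid K) z = {\<Sum>x\<in>#z. the_elem x}"
proof -
  let ?R = "reduced_monoid (multiset_monoid K)"
  interpret R: comm_monoid ?R
    by (rule comm_monoid_reduced)
  have "finprod ?R (\<lambda>u. u [^]\<^bsub>?R\<^esub> k u) S = {\<Sum>u\<in>S. repeat_mset (k u) (the_elem u)}"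
    if "finite S" "S \<subseteq> (\<lambda>a. {a}) ` K" for S and k :: "_ \<Rightarrow> nat"
    using that
  proof (induction S)
    case empty
    then show ?case by (simp add: reduced_simps)
  next
    case (insert u S)
    then have "(\<lambda>u. u [^]\<^bsub>?R\<^esub> k u) \<in> S \<rightarrow> carrier ?R" "u [^]\<^bsub>?R\<^esub> k u \<in> carrier ?R"
      by (auto simp: reduced_simps reduced_pow repeat_mem)
    with insert show ?case
      by (auto simp: reduced_mult reduced_pow)
  qed
  then have "factorization_hom (multiset_monoid K) z =
      {\<Sum>u\<in>set_mset z. repeat_mset (count z u) (the_elem u)}"
    unfolding factorization_hom_def using assms by simp
  also have "(\<Sum>u\<in>set_mset z. repeat_mset (count z u) (the_elem u)) = (\<Sum>x\<in>#z. the_elem x)"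
    by (simp only: sum_mset_image_eq_sum_repeat_mset)
  finally show ?thesis .
qed

lemma mem_factorizations_iff:
  "z \<in> factorizations (multiset_monoid K) a \<longleftrightarrow>
     set_mset z \<subseteq> atoms (reduced_monoid (multiset_monoid K)) \<and> (\<Sum>x\<in>#z. the_elem x) = a"
proof -
  have "atoms (reduced_monoid (multiset_monoid K)) \<subseteq> (\<lambda>a. {a}) ` K"
    by (auto simp: atoms_reduced)
  then have *: "factorization_hom (multiset_monoid K) z = {\<Sum>x\<in>#z. the_elem x}"
    if "set_mset z \<subseteq> atoms (reduced_monoid (multiset_monoid K))"
    by (intro factorization_hom_eq order_trans[OF that])
  have "z \<in> factorizations (multiset_monoid K) a \<longleftrightarrow>
      set_mset z \<subseteq> atoms (reduced_monoid (multiset_monoid K)) \<and>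
      factorization_hom (multiset_monoid K) z = {a}"
    by (simp only: factorizations_def factorization_monoid_def free_abelian_monoid_eq l_coset_Units
        multiset_monoid_simps mem_Collect_eq)
  also have "\<dots> \<longleftrightarrow> set_mset z \<subseteq> atoms (reduced_monoid (multiset_monoid K)) \<and> (\<Sum>x\<in>#z. the_elem x) = a"
    by (rule conj_cong[OF refl]) (subst *, simp_all)
  finally show ?thesis .
qed

end

lemma mem_factorizations_with_iff:
  "z \<in> factorizations_with H a u \<longleftrightarrow> z \<in> factorizations H a \<and> u \<in># z"
proof -
  have "z \<in> add_mset u ` carrier (factorization_monoid H)"
    if "z \<in> factorizations H a" "u \<in># z"
  proof (rule image_eqI)
    show "z = add_mset u (z - {#u#})"
      using that by simp
    show "z - {#u#} \<in> carrier (factorization_monoid H)"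
      using that by (auto simp: factorizations_def factorization_monoid_def
          free_abelian_monoid_eq dest: in_diffD)
  qed
  then show ?thesis
    by (auto simp: factorizations_with_def)
qed

section \<open>Divisor theories of saturated submonoids\<close>

lemma ex_image_mset_preimage:
  assumes "set_mset \<beta> \<subseteq> e ` P"
  obtains \<alpha> where "\<beta> = image_mset e \<alpha>" "set_mset \<alpha> \<subseteq> P"
proof
  have "image_mset e (image_mset (inv_into P e) \<beta>) = image_mset (\<lambda>x. x) \<beta>"
    unfolding image_mset.compositionality o_def
    using assms by (intro image_mset_cong) (auto simp: f_inv_into_f subset_eq)
  then show "\<beta> = image_mset e (image_mset (inv_into P e) \<beta>)"
    by simp
  show "set_mset (image_mset (inv_into P e) \<beta>) \<subseteq> P"
    using assms by (auto intro: inv_into_into)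
qed

text \<open>
  The divisor theory is the inclusion up to the renaming \<open>e\<close> of primes, which is there
  because the primes of a divisor theory are required to have a prescribed type. In a free
  abelian monoid divisibility is inclusion and gcds are intersections, so an inclusion that
  reflects divisibility (\<open>saturated\<close>) only needs every multiset to be an intersection of
  members.
\<close>

lemma divisor_theory_image_mset:
  fixes e :: "'a \<Rightarrow> 'p"
  assumes "multiset_submonoid K"
    and inj: "inj e"
    and sub: "\<And>a. a \<in> K \<Longrightarrow> set_mset a \<subseteq> P"
    and saturated: "\<And>a b. a \<in> K \<Longrightarrow> b \<in> K \<Longrightarrow> a \<subseteq># b \<Longrightarrow> b - a \<in> K"
    and gcds: "\<And>\<alpha>. set_mset \<alpha> \<subseteq> P \<Longrightarrow> \<exists>a\<in>K. \<exists>b\<in>K. \<alpha> = a \<inter># b"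
  shows "divisor_theory (multiset_monoid K) (e ` P) (image_mset e)"
proof -
  interpret multiset_submonoid K by fact
  have cnt: "count (image_mset e M) (e p) = count M p" for M p
    using inj by (induction M) (auto simp: inj_eq)
  have inter: "image_mset e (a \<inter># b) = image_mset e a \<inter># image_mset e b" for a b
  proof (rule multiset_eqI)
    fix q
    show "count (image_mset e (a \<inter># b)) q = count (image_mset e a \<inter># image_mset e b) q"
    proof (cases "q \<in> range e")
      case False
      then have "q \<notin># image_mset e M" for M by auto
      then show ?thesis by (simp only: count_inter_mset not_in_iff)
    qed (auto simp: cnt)
  qed
  have sube: "a \<subseteq># b" if "image_mset e a \<subseteq># image_mset e b" for a b
    using that cnt by (metis subseteq_mset_def)
  have sub': "set_mset (image_mset e a) \<subseteq> e ` P" if "a \<in> K" for a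
    using sub[OF that] by auto
  show ?thesis
    unfolding divisor_theory_def
  proof (intro conjI ballI impI)
    show "image_mset e \<in> hom (multiset_monoid K) (free_abelian_monoid (e ` P))"
      using sub by (fastforce simp: hom_def free_abelian_monoid_eq)
  next
    fix a b
    assume K: "a \<in> carrier (multiset_monoid K)" "b \<in> carrier (multiset_monoid K)"
      and "image_mset e a divides\<^bsub>free_abelian_monoid (e ` P)\<^esub> image_mset e b"
    then have "a \<subseteq># b"
      using sube sub' by (simp add: divides_free_abelian_monoid)
    then show "a divides\<^bsub>multiset_monoid K\<^esub> b"
      using K saturated unfolding factor_def by (intro bexI[of _ "b - a"]) auto
  next
    fix \<beta>
    assume "\<beta> \<in> carrier (free_abelian_monoid (e ` P))"
    then have \<beta>: "set_mset \<beta> \<subseteq> e ` P"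
      by (simp add: free_abelian_monoid_eq)
    then obtain \<alpha> where \<alpha>: "\<beta> = image_mset e \<alpha>" "set_mset \<alpha> \<subseteq> P"
      by (rule ex_image_mset_preimage)
    from gcds[OF \<alpha>(2)] obtain a b where ab: "a \<in> K" "b \<in> K" and "\<alpha> = a \<inter># b"
      by blast
    with \<alpha>(1) have *: "\<beta> = image_mset e a \<inter># image_mset e b"
      by (simp add: inter)
    show "\<exists>A\<subseteq>carrier (multiset_monoid K). finite A \<and> A \<noteq> {} \<and>
        is_gcd_of_set (free_abelian_monoid (e ` P)) \<beta> (image_mset e ` A)"
    proof (intro exI[of _ "{a, b}"] conjI)
      have "c divides\<^bsub>free_abelian_monoid (e ` P)\<^esub> \<beta> \<longleftrightarrow>
          c divides\<^bsub>free_abelian_monoid (e ` P)\<^esub> image_mset e a \<and>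
          c divides\<^bsub>free_abelian_monoid (e ` P)\<^esub> image_mset e b" for c
        using \<beta> sub'[OF ab(1)] sub'[OF ab(2)]
        by (simp add: divides_free_abelian_monoid *)
      moreover have "\<beta> divides\<^bsub>free_abelian_monoid (e ` P)\<^esub> \<beta>"
        using \<beta> by (simp add: divides_free_abelian_monoid)
      ultimately show "is_gcd_of_set (free_abelian_monoid (e ` P)) \<beta> (image_mset e ` {a, b})"
        using \<beta> by (auto simp: is_gcd_of_set_def free_abelian_monoid_eq)
    qed (use ab in auto)
  qed
qed

text \<open>
  With trivial units, \<^const>\<open>the_elem\<close> is an isomorphism from the reduced monoid to the monoid
  itself.
\<close>

lemma divisor_theory_reduced:
  assumes "multiset_submonoid K" "divisor_theory (multiset_monoid K) P \<phi>"
  shows "divisor_theory (reduced_monoid (multiset_monoid K)) P (\<lambda>X. \<phi> (the_elem X))"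
proof -
  interpret multiset_submonoid K by fact
  have "\<exists>A\<subseteq>carrier (reduced_monoid (multiset_monoid K)). finite A \<and> A \<noteq> {} \<and>
      is_gcd_of_set (free_abelian_monoid P) \<alpha> ((\<lambda>X. \<phi> (the_elem X)) ` A)"
    if \<alpha>: "\<alpha> \<in> carrier (free_abelian_monoid P)" for \<alpha>
  proof -
    obtain A where A: "A \<subseteq> K" "finite A" "A \<noteq> {}"
      "is_gcd_of_set (free_abelian_monoid P) \<alpha> (\<phi> ` A)"
      using assms(2) \<alpha> unfolding divisor_theory_def multiset_monoid_simps by blast
    then show ?thesis
      by (intro exI[of _ "(\<lambda>a. {a}) ` A"]) (auto simp: reduced_simps image_image)
  qed
  moreover have "a divides\<^bsub>multiset_monoid K\<^esub> b \<Longrightarrow>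
      {a} divides\<^bsub>reduced_monoid (multiset_monoid K)\<^esub> {b}" for a b
    unfolding divides_reduced by (auto simp: factor_def)
  ultimately show ?thesis
    using assms(2)
    by (auto simp: divisor_theory_def hom_def reduced_simps reduced_mult)
qed

section \<open>Class groups\<close>

lemma fraction_eq:
  assumes "set_mset a \<subseteq> P" "set_mset b \<subseteq> P"
  shows "fraction (free_abelian_monoid P) a b =
    {(c, d). set_mset c \<subseteq> P \<and> set_mset d \<subseteq> P \<and> a + d = c + b}"
  using assms by (auto simp: fraction_def fraction_rel_def free_abelian_monoid_eq)

lemma fraction_mult:
  fixes P :: "'p set"
  assumes "set_mset a \<subseteq> P" "set_mset b \<subseteq> P" "set_mset c \<subseteq> P" "set_mset d \<subseteq> P"
  defines "F \<equiv> free_abelian_monoid P"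
  shows "fraction F a b \<otimes>\<^bsub>quotient_group F\<^esub> fraction F c d = fraction F (a + c) (b + d)"
proof -
  have *: "fraction F (a' + c') (b' + d') = fraction F (a + c) (b + d)"
    if "(a', b') \<in> fraction F a b" "(c', d') \<in> fraction F c d" for a' b' c' d'
  proof -
    from that assms have S: "set_mset a' \<subseteq> P" "set_mset b' \<subseteq> P" "set_mset c' \<subseteq> P" "set_mset d' \<subseteq> P"
      and E: "a + b' = a' + b" "c + d' = c' + d"
      by (auto simp: fraction_eq)
    have "(a' + c') + y = x + (b' + d') \<longleftrightarrow> (a + c) + y = x + (b + d)" for x y
    proof (unfold multiset_eq_iff, rule all_cong1)
      fix p
      have "count a p + count b' p = count a' p + count b p"
           "count c p + count d' p = count c' p + count d p"
        using E by (metis count_union)+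
      then show "(count (a' + c' + y) p = count (x + (b' + d')) p) =
          (count (a + c + y) p = count (x + (b + d)) p)" by auto
    qed
    then show ?thesis
      using S assms by (auto simp: fraction_eq)
  qed
  have "(a, b) \<in> fraction F a b" "(c, d) \<in> fraction F c d"
    using assms by (auto simp: fraction_eq)
  then have "fraction F (a + c) (b + d) =
      (\<Union>q\<in>fraction F a b. \<Union>r\<in>fraction F c d. fraction F (a + c) (b + d))"
    by blast
  also have "\<dots> = (\<Union>q\<in>fraction F a b. \<Union>r\<in>fraction F c d.
      fraction F (fst q + fst r) (snd q + snd r))"
    using * by (intro SUP_cong refl) simp
  finally show ?thesis
    by (simp add: quotient_group_def F_def free_abelian_monoid_eq case_prod_unfold)
qed

text \<open>
  Division with remainder by \<open>e\<close>, applied to all multiplicities at once.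
\<close>

lemma ex_mod_decomposition:
  fixes \<alpha> :: "'p multiset"
  assumes "e > 0"
  obtains \<rho> \<delta> where "\<alpha> = \<rho> + repeat_mset e \<delta>" "set_mset \<rho> \<subseteq> set_mset \<alpha>" "set_mset \<delta> \<subseteq> set_mset \<alpha>"
    "\<And>p. count \<rho> p < e"
proof
  define \<delta> where "\<delta> = (\<Sum>p\<in>set_mset \<alpha>. replicate_mset (count \<alpha> p div e) p)"
  have cnt: "count \<delta> p = count \<alpha> p div e" for p
    by (auto simp: \<delta>_def count_sum count_eq_zero_iff[THEN iffD2])
  then have cnt2: "count (\<alpha> - repeat_mset e \<delta>) p = count \<alpha> p mod e" for p
    by (simp add: minus_mult_div_eq_mod)
  show "count (\<alpha> - repeat_mset e \<delta>) p < e" for p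
    using assms by (simp only: cnt2) simp
  show "\<alpha> = (\<alpha> - repeat_mset e \<delta>) + repeat_mset e \<delta>"
    by (rule multiset_eqI) (use cnt cnt2 in simp)
  show "set_mset (\<alpha> - repeat_mset e \<delta>) \<subseteq> set_mset \<alpha>"
    by (auto dest: in_diffD)
  show "set_mset \<delta> \<subseteq> set_mset \<alpha>"
    by (auto simp: cnt count_eq_zero_iff simp flip: count_greater_zero_iff) (metis div_0 count_eq_zero_iff less_irrefl neq0_conv)
qed

lemma finite_bounded_multisets:
  assumes "finite P"
  shows "finite {\<rho>. set_mset \<rho> \<subseteq> P \<and> (\<forall>p. count \<rho> p < e)}"
proof (rule finite_subset)
  show "finite (\<Union>n\<le>card P * e. multisets_of_size P n)"
    using assms by auto
  have "size \<rho> \<le> card P * e" if "set_mset \<rho> \<subseteq> P" "\<forall>p. count \<rho> p < e" for \<rho>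
  proof -
    have "size \<rho> \<le> card (set_mset \<rho>) * e"
      using that sum_bounded_above[of "set_mset \<rho>" "count \<rho>" e]
      by (simp add: size_multiset_overloaded_eq less_imp_le)
    also have "\<dots> \<le> card P * e"
      using that assms by (intro mult_right_mono card_mono) auto
    finally show ?thesis .
  qed
  then show "{\<rho>. set_mset \<rho> \<subseteq> P \<and> (\<forall>p. count \<rho> p < e)} \<subseteq> (\<Union>n\<le>card P * e. multisets_of_size P n)"
    by (auto simp: multisets_of_size_def)
qed

text \<open>
  If \<open>e\<close> annihilates the class group, then the class of a fraction \<open>a / b\<close> is the class of
  \<open>a b\<^bsup>e-1\<^esup>\<close>, because \<open>b\<^sup>e\<close> lies in the image of \<open>H\<close>; and in \<open>a b\<^bsup>e-1\<^esup>\<close> all exponents can be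
  reduced modulo \<open>e\<close>. With finitely many primes, only finitely many multisets have all
  multiplicities below \<open>e\<close>.
\<close>

lemma finite_class_group:
  fixes H :: "('a, 'm) monoid_scheme" and P :: "'p set" and \<iota> :: "'a set \<Rightarrow> 'p multiset"
  defines "L \<equiv> \<iota> ` carrier (reduced_monoid H)"
  assumes "finite P" "e > 0"
    and sub: "\<And>a. a \<in> L \<Longrightarrow> set_mset a \<subseteq> P"
    and add: "\<And>a b. a \<in> L \<Longrightarrow> b \<in> L \<Longrightarrow> a + b \<in> L"
    and exponent: "\<And>\<alpha>. set_mset \<alpha> \<subseteq> P \<Longrightarrow> repeat_mset e \<alpha> \<in> L"
  shows "finite (carrier (class_group H P \<iota>))"
proof -
  let ?F = "free_abelian_monoid P"
  let ?G = "quotient_group ?F"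
  define N where "N = {fraction ?F a b | a b. a \<in> L \<and> b \<in> L}"
  have coset: "N #>\<^bsub>?G\<^esub> fraction ?F a b =
      {fraction ?F (h + a) (k + b) | h k. h \<in> L \<and> k \<in> L}"
    if "set_mset a \<subseteq> P" "set_mset b \<subseteq> P" for a b
  proof -
    have mult: "fraction ?F h k \<otimes>\<^bsub>?G\<^esub> fraction ?F a b = fraction ?F (h + a) (k + b)"
      if "h \<in> L" "k \<in> L" for h k
      using that \<open>set_mset a \<subseteq> P\<close> \<open>set_mset b \<subseteq> P\<close> by (intro fraction_mult) (simp_all add: sub)
    have "N #>\<^bsub>?G\<^esub> fraction ?F a b =
        {fraction ?F h k \<otimes>\<^bsub>?G\<^esub> fraction ?F a b | h k. h \<in> L \<and> k \<in> L}"
      by (auto simp only: r_coset_def N_def)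
    also have "\<dots> = {fraction ?F (h + a) (k + b) | h k. h \<in> L \<and> k \<in> L}"
      by (intro Collect_cong ex_cong1 iffI; elim conjE; simp only: mult)
    finally show ?thesis .
  qed
  have "class_group H P \<iota> = ?G Mod N"
    unfolding class_group_def N_def L_def
    by (rule arg_cong[where f = "\<lambda>S. ?G Mod S"]) auto
  then have "carrier (class_group H P \<iota>) = (\<Union>x\<in>carrier ?G. {N #>\<^bsub>?G\<^esub> x})"
    by (simp add: FactGroup_def RCOSETS_def)
  also have "\<dots> \<subseteq> (\<lambda>\<rho>. N #>\<^bsub>?G\<^esub> fraction ?F \<rho> {#}) ` {\<rho>. set_mset \<rho> \<subseteq> P \<and> (\<forall>p. count \<rho> p < e)}"
  proof clarify
    fix x
    assume "x \<in> carrier ?G"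
    then obtain a b where ab: "set_mset a \<subseteq> P" "set_mset b \<subseteq> P" and x: "x = fraction ?F a b"
      by (auto simp: quotient_group_def quotient_def fraction_def free_abelian_monoid_eq)
    have sb: "set_mset (repeat_mset (e - 1) b) \<subseteq> P"
      using ab(2) by (auto simp flip: count_greater_zero_iff)
    have eb: "b + repeat_mset (e - 1) b = repeat_mset e b"
      using \<open>e > 0\<close> by (cases e) auto
    obtain \<rho> \<delta> where \<rho>: "a + repeat_mset (e - 1) b = \<rho> + repeat_mset e \<delta>"
      "set_mset \<rho> \<subseteq> set_mset (a + repeat_mset (e - 1) b)"
      "set_mset \<delta> \<subseteq> set_mset (a + repeat_mset (e - 1) b)"
      "\<And>p. count \<rho> p < e"
      using ex_mod_decomposition[OF \<open>e > 0\<close>, of "a + repeat_mset (e - 1) b"] by metis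
    have P: "set_mset \<rho> \<subseteq> P" "set_mset \<delta> \<subseteq> P"
      using \<rho>(2,3) ab(1) sb by auto
    let ?h = "repeat_mset e \<delta>" and ?k = "repeat_mset e b"
    have hk: "?h \<in> L" "?k \<in> L"
      using exponent P ab by auto
    \<comment> \<open>Extending the fraction turns its denominator into a member of the submonoid.\<close>
    have "x = fraction ?F (a + repeat_mset (e - 1) b) (b + repeat_mset (e - 1) b)"
      using ab sb by (auto simp: x fraction_eq ac_simps)
    then have x': "x = fraction ?F (\<rho> + ?h) ?k"
      by (simp only: eb \<rho>(1))
    have "N #>\<^bsub>?G\<^esub> x = N #>\<^bsub>?G\<^esub> fraction ?F \<rho> {#}"
    proof -
      have "\<exists>h' k'. fraction ?F (h + (\<rho> + ?h)) (k + ?k) = fraction ?F (h' + \<rho>) k' \<and> h' \<in> L \<and> k' \<in> L"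
        if "h \<in> L" "k \<in> L" for h k
        by (rule exI[of _ "h + ?h"], rule exI[of _ "k + ?k"]) (use that hk add in \<open>auto simp: ac_simps\<close>)
      \<comment> \<open>Conversely, extend a fraction of the second coset by both \<open>?h\<close> and \<open>?k\<close>.\<close>
      moreover have "\<exists>h' k'. fraction ?F (h + \<rho>) k = fraction ?F (h' + (\<rho> + ?h)) (k' + ?k) \<and> h' \<in> L \<and> k' \<in> L"
        if hk': "h \<in> L" "k \<in> L" for h k
      proof (intro exI conjI)
        have "set_mset h \<subseteq> P" "set_mset k \<subseteq> P" "set_mset ?h \<subseteq> P" "set_mset ?k \<subseteq> P"
          using hk hk' sub by blast+
        moreover have "count (h + \<rho>) p + count d p = count c p + count k p \<longleftrightarrow>
            count ((h + ?k) + (\<rho> + ?h)) p + count d p = count c p + count ((k + ?h) + ?k) p" for p c d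
          by (simp add: add.assoc)
        ultimately show "fraction ?F (h + \<rho>) k = fraction ?F ((h + ?k) + (\<rho> + ?h)) ((k + ?h) + ?k)"
          using P by (simp add: fraction_eq multiset_eq_iff)
      qed (use hk hk' add in auto)
      ultimately show ?thesis
        using P sub[OF hk(1)] sub[OF hk(2)] unfolding x' by (simp add: coset) blast
    qed
    then show "N #>\<^bsub>?G\<^esub> x \<in> (\<lambda>\<rho>. N #>\<^bsub>?G\<^esub> fraction ?F \<rho> {#}) ` {\<rho>. set_mset \<rho> \<subseteq> P \<and> (\<forall>p. count \<rho> p < e)}"
      using P(1) \<rho>(4) by blast
  qed
  finally show ?thesis
    by (rule finite_subset) (rule finite_imageI[OF finite_bounded_multisets[OF \<open>finite P\<close>]])
qed

section \<open>Tame degrees\<close>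

lemma factorization_dist_self: "factorization_dist z z = 0"
  by (simp add: factorization_dist_def)

text \<open>
  Factorizations that already contain \<open>u\<close> are at distance 0 from one containing \<open>u\<close>, so only
  those without \<open>u\<close> matter. If their distances to the nearest factorization with \<open>u\<close> are all
  equal to \<open>N\<close>, the tame degree is \<open>N\<close> as soon as both kinds of factorization exist.
\<close>

lemma tame_degree_eq:
  assumes lower: "\<And>z z'. z \<in> factorizations H a \<Longrightarrow> u \<notin># z \<Longrightarrow>
      z' \<in> factorizations_with H a u \<Longrightarrow> N \<le> factorization_dist z z'"
    and upper: "\<And>z z'. z \<in> factorizations H a \<Longrightarrow> u \<notin># z \<Longrightarrow>
      z' \<in> factorizations_with H a u \<Longrightarrow>
      \<exists>y\<in>factorizations_with H a u. factorization_dist z y \<le> N"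
  shows "tame_degree H a u =
    (if (\<exists>z\<in>factorizations H a. u \<notin># z) \<and> factorizations_with H a u \<noteq> {} then enat N else 0)"
proof (cases "(\<exists>z\<in>factorizations H a. u \<notin># z) \<and> factorizations_with H a u \<noteq> {}")
  case True
  then obtain z0 where z0: "z0 \<in> factorizations H a" "u \<notin># z0" and ne: "factorizations_with H a u \<noteq> {}"
    by blast
  have "tame_degree H a u = enat N"
    unfolding tame_degree_def
  proof (rule Least_equality)
    have "\<exists>y\<in>factorizations_with H a u. factorization_dist z y \<le> N" if "z \<in> factorizations H a" for z
    proof (cases "u \<in># z")
      case True
      then show ?thesis
        using that by (intro bexI[of _ z]) (auto simp: factorization_dist_self mem_factorizations_with_iff)
    qed (use upper ne that in blast)
    then show "factorizations_with H a u \<noteq> {} \<longrightarrow> (\<forall>z\<in>factorizations H a.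
        \<exists>z'\<in>factorizations_with H a u. enat (factorization_dist z z') \<le> enat N)"
      by simp
  next
    fix M
    assume "factorizations_with H a u \<noteq> {} \<longrightarrow> (\<forall>z\<in>factorizations H a.
       \<exists>z'\<in>factorizations_with H a u. enat (factorization_dist z z') \<le> M)"
    then obtain z' where z': "z' \<in> factorizations_with H a u" "enat (factorization_dist z0 z') \<le> M"
      using z0 ne by blast
    have "enat N \<le> enat (factorization_dist z0 z')"
      using lower[OF z0 z'(1)] by simp
    then show "enat N \<le> M"
      using z'(2) by (rule order_trans)
  qed
  then show ?thesis using True by simp
next
  case False
  have "\<exists>y\<in>factorizations_with H a u. enat (factorization_dist z y) \<le> 0"
    if "factorizations_with H a u \<noteq> {}" "z \<in> factorizations H a" for z
    using that False
    by (intro bexI[of _ z]) (auto simp: factorization_dist_self mem_factorizations_with_iff zero_enat_def)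
  then have "tame_degree H a u = 0"
    unfolding tame_degree_def by (intro Least_equality) auto
  with False show ?thesis by (auto simp only: if_False)
qed

lemma factorization_dist_exchange:
  assumes "X \<inter># Y = {#}"
  shows "factorization_dist (g + X) (g + Y) = max (size X) (size Y)"
proof -
  have "(g + X) \<inter># (g + Y) = g"
  proof (rule multiset_eqI)
    fix x
    have "min (count X x) (count Y x) = 0"
      using assms by (metis count_empty count_inter_mset)
    then show "count ((g + X) \<inter># (g + Y)) x = count g x" by auto
  qed
  then show ?thesis
    by (simp add: factorization_dist_def)
qed

text \<open>
  Lower bounds on distances come from looking at the multiplicity of a single atom.
\<close>

lemma count_le_factorization_dist:
  "count z x \<le> count z' x + factorization_dist z z'"
  "count z' x \<le> count z x + factorization_dist z z'"
  using count_le_size[of "z - z \<inter># z'" x] count_le_size[of "z' - z \<inter># z'" x]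
  by (auto simp: factorization_dist_def)

section \<open>Monoids with one exchange relation for each modulus\<close>

definition A_atom :: "nat \<Rightarrow> nat multiset" where "A_atom n = replicate_mset n (2 * n)"
definition B_atom :: "nat \<Rightarrow> nat multiset" where "B_atom n = replicate_mset n (2 * n + 1)"
definition W_atom :: "nat \<Rightarrow> nat multiset" where "W_atom n = {#2 * n, 2 * n + 1#}"

lemma even_odd_neq [simp]: "2 * m \<noteq> Suc (2 * n)" "Suc (2 * n) \<noteq> 2 * m" for m n :: nat
  by presburger+

lemma count_A_atom: "count (A_atom n) p = (if p = 2 * n then n else 0)"
  and count_B_atom: "count (B_atom n) p = (if p = 2 * n + 1 then n else 0)"
  and count_W_atom: "count (W_atom n) p = (if p = 2 * n \<or> p = 2 * n + 1 then 1 else 0)"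
  by (auto simp: A_atom_def B_atom_def W_atom_def)

lemma atom_eq_iff [simp]:
  "A_atom m = A_atom n \<longleftrightarrow> m = n" "B_atom m = B_atom n \<longleftrightarrow> m = n" "W_atom m = W_atom n \<longleftrightarrow> m = n"
  "A_atom m = B_atom n \<longleftrightarrow> m = 0 \<and> n = 0" "B_atom n = A_atom m \<longleftrightarrow> m = 0 \<and> n = 0"
  "A_atom m \<noteq> W_atom n" "W_atom n \<noteq> A_atom m" "B_atom m \<noteq> W_atom n" "W_atom n \<noteq> B_atom m"
proof -
  show "A_atom m = A_atom n \<longleftrightarrow> m = n" "B_atom m = B_atom n \<longleftrightarrow> m = n"
    by (auto simp: A_atom_def B_atom_def replicate_mset_eq_iff)
  have "m = n" if "W_atom m = W_atom n"
    using arg_cong[OF that, of "\<lambda>M. count M (2 * m)"] by (simp add: count_W_atom split: if_splits)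
  then show "W_atom m = W_atom n \<longleftrightarrow> m = n" by auto
  have "m = 0 \<and> n = 0" if "A_atom m = B_atom n"
    using arg_cong[OF that, of "\<lambda>M. count M (2 * m)"] arg_cong[OF that, of "\<lambda>M. count M (2 * n + 1)"]
    by (simp add: count_A_atom count_B_atom)
  then show "A_atom m = B_atom n \<longleftrightarrow> m = 0 \<and> n = 0" "B_atom n = A_atom m \<longleftrightarrow> m = 0 \<and> n = 0"
    by (auto simp: A_atom_def B_atom_def)
  have "count (A_atom m) (2 * n + 1) \<noteq> count (W_atom n) (2 * n + 1)"
    by (simp add: count_A_atom count_W_atom)
  then show "A_atom m \<noteq> W_atom n" "W_atom n \<noteq> A_atom m" by auto
  have "count (B_atom m) (2 * n) \<noteq> count (W_atom n) (2 * n)"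
    by (simp add: count_B_atom count_W_atom)
  then show "B_atom m \<noteq> W_atom n" "W_atom n \<noteq> B_atom m" by auto
qed

definition exchange_primes :: "nat set \<Rightarrow> nat set" where
  "exchange_primes C = (\<Union>n\<in>C. {2 * n, 2 * n + 1})"

text \<open>
  The congruence \<open>count M (2 * n) \<equiv> count M (2 * n + 1)\<close> modulo \<open>n\<close> is stated over the integers,
  so that it is visibly closed under addition and subtraction.
\<close>

definition balanced :: "nat set \<Rightarrow> nat multiset set" where
  "balanced C = {M. set_mset M \<subseteq> exchange_primes C \<and>
     (\<forall>n\<in>C. int n dvd int (count M (2 * n)) - int (count M (2 * n + 1)))}"

lemma multiset_submonoid_balanced: "multiset_submonoid (balanced C)"
proof
  fix a b
  assume ab: "a \<in> balanced C" "b \<in> balanced C"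
  have "int n dvd (int (count a (2 * n)) - int (count a (2 * n + 1))) +
      (int (count b (2 * n)) - int (count b (2 * n + 1)))" if "n \<in> C" for n
    using ab that by (intro dvd_add) (auto simp: balanced_def)
  then show "a + b \<in> balanced C"
    using ab by (auto simp: balanced_def algebra_simps)
qed (auto simp: balanced_def)

interpretation balanced: multiset_submonoid "balanced C" for C
  by (rule multiset_submonoid_balanced)

lemma balanced_diff:
  assumes "a \<in> balanced C" "b \<in> balanced C" "a \<subseteq># b"
  shows "b - a \<in> balanced C"
proof -
  have "int n dvd int (count (b - a) (2 * n)) - int (count (b - a) (2 * n + 1))" if "n \<in> C" for n
  proof -
    have "count a p \<le> count b p" for p
      using assms(3) by (rule mset_subset_eq_count)
    then have "int (count (b - a) (2 * n)) - int (count (b - a) (2 * n + 1)) =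
        (int (count b (2 * n)) - int (count b (2 * n + 1))) -
        (int (count a (2 * n)) - int (count a (2 * n + 1)))"
      by (simp add: of_nat_diff)
    also have "int n dvd \<dots>"
      using assms(1,2) that by - (rule dvd_diff; simp add: balanced_def)
    finally show ?thesis .
  qed
  then show ?thesis
    using assms by (auto simp: balanced_def dest: in_diffD)
qed

context
  fixes C :: "nat set"
  assumes finite_C: "finite C" and C_ge_2: "C \<subseteq> {2..}"
begin

lemma ge_2: "n \<in> C \<Longrightarrow> 2 \<le> n"
  using C_ge_2 by auto

text \<open>
  The multiplicities \<open>x n\<close> of \<open>2 n + 1\<close> and \<open>y n\<close> of \<open>2 n\<close> below are chosen so that adding
  either one makes the two multiplicities in \<open>\<alpha>\<close> congruent modulo \<open>n\<close>; the factor \<open>n - 1\<close>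
  stands for \<open>-1\<close>. The two completions add disjoint sets of primes, so they have gcd \<open>\<alpha>\<close>.
\<close>

lemma balanced_gcd:
  assumes "set_mset \<alpha> \<subseteq> exchange_primes C"
  shows "\<exists>a\<in>balanced C. \<exists>b\<in>balanced C. \<alpha> = a \<inter># b"
proof -
  define x where "x n = count \<alpha> (2 * n) + (n - 1) * count \<alpha> (2 * n + 1)" for n
  define y where "y n = count \<alpha> (2 * n + 1) + (n - 1) * count \<alpha> (2 * n)" for n
  define X where "X = (\<Sum>n\<in>C. replicate_mset (x n) (2 * n + 1))"
  define Y where "Y = (\<Sum>n\<in>C. replicate_mset (y n) (2 * n))"
  have X: "count X (2 * n) = 0" "n \<in> C \<Longrightarrow> count X (2 * n + 1) = x n" for n
    using finite_C by (simp_all add: X_def count_sum)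
  have Y: "count Y (2 * n + 1) = 0" "n \<in> C \<Longrightarrow> count Y (2 * n) = y n" for n
    using finite_C by (simp_all add: Y_def count_sum)
  have 1: "set_mset X \<subseteq> exchange_primes C" "set_mset Y \<subseteq> exchange_primes C"
    using finite_C by (auto simp: X_def Y_def exchange_primes_def set_mset_sum split: if_splits)
  have dx: "int n dvd int (count (\<alpha> + X) (2 * n)) - int (count (\<alpha> + X) (2 * n + 1))"
    if "n \<in> C" for n
  proof -
    have "int (count (\<alpha> + X) (2 * n)) - int (count (\<alpha> + X) (2 * n + 1)) =
        int n * - int (count \<alpha> (2 * n + 1))"
      using ge_2[OF that] X(1)[of n] X(2)[OF that] by (simp add: x_def of_nat_diff left_diff_distrib)
    then show ?thesis by (metis dvd_triv_left)
  qed
  have dy: "int n dvd int (count (\<alpha> + Y) (2 * n)) - int (count (\<alpha> + Y) (2 * n + 1))"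
    if "n \<in> C" for n
  proof -
    have "int (count (\<alpha> + Y) (2 * n)) - int (count (\<alpha> + Y) (2 * n + 1)) =
        int n * int (count \<alpha> (2 * n))"
      using ge_2[OF that] Y(1)[of n] Y(2)[OF that] by (simp add: y_def of_nat_diff left_diff_distrib)
    then show ?thesis by (metis dvd_triv_left)
  qed
  have "\<alpha> = (\<alpha> + X) \<inter># (\<alpha> + Y)"
  proof (rule multiset_eqI)
    fix p
    have "count X p = 0 \<or> count Y p = 0"
    proof (cases "even p")
      case True
      then show ?thesis using X(1) by (elim evenE) simp
    next
      case False
      then show ?thesis using Y(1) by (elim oddE) simp
    qed
    then show "count \<alpha> p = count ((\<alpha> + X) \<inter># (\<alpha> + Y)) p" by auto
  qed
  moreover have "\<alpha> + X \<in> balanced C" "\<alpha> + Y \<in> balanced C"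
    using dx dy assms 1 by (auto simp: balanced_def)
  ultimately show ?thesis by blast
qed

lemma divisor_theory_balanced:
  fixes e :: "nat \<Rightarrow> 'p"
  assumes "inj e"
  shows "divisor_theory (multiset_monoid (balanced C)) (e ` exchange_primes C) (image_mset e)"
  using multiset_submonoid_balanced assms
  by (rule divisor_theory_image_mset) (simp add: balanced_def, erule (2) balanced_diff, erule balanced_gcd)

lemma krull_monoid_balanced: "krull_monoid (multiset_monoid (balanced C))"
proof -
  have "inj (\<lambda>p::nat. {{#p#}})"
    by (rule injI) simp
  then show ?thesis
    unfolding krull_monoid_def
    by (intro conjI exI balanced.comm_monoid_cancel) (rule divisor_theory_balanced)
qed

lemma repeat_prod_mem_balanced:
  assumes "set_mset \<alpha> \<subseteq> exchange_primes C"
  shows "repeat_mset (\<Prod>C) \<alpha> \<in> balanced C"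
proof -
  have "int n dvd int (\<Prod>C * k) - int (\<Prod>C * l)" if "n \<in> C" for n k l
    using finite_C that by (intro dvd_diff) (auto intro: dvd_mult2 simp: dvd_prodI)
  then show ?thesis
    using assms by (auto simp: balanced_def simp flip: count_greater_zero_iff)
qed

lemma has_finite_class_group_balanced: "has_finite_class_group (multiset_monoid (balanced C))"
proof -
  let ?e = "\<lambda>p::nat. {{#p#}}"
  let ?\<iota> = "\<lambda>X. image_mset ?e (the_elem X)"
  have "inj ?e"
    by (rule injI) simp
  then have dt: "divisor_theory (reduced_monoid (multiset_monoid (balanced C)))
      (?e ` exchange_primes C) ?\<iota>"
    by (intro divisor_theory_reduced multiset_submonoid_balanced divisor_theory_balanced)
  have fin: "finite (carrier (class_group (multiset_monoid (balanced C)) (?e ` exchange_primes C) ?\<iota>))"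
  proof (rule finite_class_group[where e = "\<Prod>C"])
    have L: "?\<iota> ` carrier (reduced_monoid (multiset_monoid (balanced C))) = image_mset ?e ` balanced C"
      by (simp add: balanced.reduced_simps image_image)
    show "finite (?e ` exchange_primes C)"
      using finite_C by (simp add: exchange_primes_def)
    show "\<Prod>C > 0"
      using ge_2 by (force intro: prod_pos)
    show "set_mset a \<subseteq> ?e ` exchange_primes C"
      if "a \<in> ?\<iota> ` carrier (reduced_monoid (multiset_monoid (balanced C)))" for a
      using that unfolding L by (fastforce simp: balanced_def)
    show "a + b \<in> ?\<iota> ` carrier (reduced_monoid (multiset_monoid (balanced C)))"
      if "a \<in> ?\<iota> ` carrier (reduced_monoid (multiset_monoid (balanced C)))"
        "b \<in> ?\<iota> ` carrier (reduced_monoid (multiset_monoid (balanced C)))" for a b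
      using that unfolding L by (auto simp: balanced.add_mem simp flip: image_mset_union)
    show "repeat_mset (\<Prod>C) \<alpha> \<in> ?\<iota> ` carrier (reduced_monoid (multiset_monoid (balanced C)))"
      if \<alpha>: "set_mset \<alpha> \<subseteq> ?e ` exchange_primes C" for \<alpha>
    proof -
      obtain \<beta> where \<beta>: "\<alpha> = image_mset ?e \<beta>" "set_mset \<beta> \<subseteq> exchange_primes C"
        using \<alpha> by (rule ex_image_mset_preimage)
      have "repeat_mset k \<alpha> = image_mset ?e (repeat_mset k \<beta>)" for k
        unfolding \<beta> by (induction k) auto
      then show ?thesis
        unfolding L by (rule image_eqI) (rule repeat_prod_mem_balanced[OF \<beta>(2)])
    qed
  qed
  show ?thesis
    unfolding has_finite_class_group_def
    by (rule exI[of _ "?e ` exchange_primes C"], rule exI[of _ ?\<iota>], rule conjI[OF dt fin])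
qed

definition exchange_atoms :: "nat multiset set" where
  "exchange_atoms = (\<Union>n\<in>C. {A_atom n, B_atom n, W_atom n})"

lemma exchange_atoms_subset: "exchange_atoms \<subseteq> balanced C"
proof
  fix u
  assume "u \<in> exchange_atoms"
  then obtain m where m: "m \<in> C" "u \<in> {A_atom m, B_atom m, W_atom m}"
    by (auto simp: exchange_atoms_def)
  then have "set_mset u \<subseteq> {2 * m, 2 * m + 1}"
    by (auto simp: A_atom_def B_atom_def W_atom_def split: if_splits)
  then have "set_mset u \<subseteq> exchange_primes C"
    using m(1) by (auto simp: exchange_primes_def)
  moreover have "int n dvd int (count u (2 * n)) - int (count u (2 * n + 1))" for n
    using m(2) by (auto simp: count_A_atom count_B_atom count_W_atom)
  ultimately show "u \<in> balanced C"
    by (simp add: balanced_def)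
qed

lemma empty_notin_exchange_atoms: "{#} \<notin> exchange_atoms"
proof
  assume "{#} \<in> exchange_atoms"
  then obtain n where "n \<in> C" "{#} \<in> {A_atom n, B_atom n, W_atom n}"
    by (auto simp: exchange_atoms_def)
  then show False
    using ge_2[of n] by (auto simp: A_atom_def B_atom_def W_atom_def)
qed

text \<open>
  If both primes of some \<open>n\<close> occur in \<open>M\<close>, then \<open>W_atom n\<close> divides \<open>M\<close>. If only one of them
  occurs, the congruence makes its multiplicity a positive multiple of \<open>n\<close>.
\<close>

lemma exchange_atom_below:
  assumes M: "M \<in> balanced C" "M \<noteq> {#}"
  shows "\<exists>u\<in>exchange_atoms. u \<subseteq># M"
proof -
  obtain n where n: "n \<in> C" "count M (2 * n) > 0 \<or> count M (2 * n + 1) > 0"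
  proof -
    obtain p where "p \<in># M"
      using M(2) by blast
    then have "p \<in> exchange_primes C"
      using M(1) by (auto simp: balanced_def)
    with \<open>p \<in># M\<close> show ?thesis
      using that by (auto simp: exchange_primes_def)
  qed
  have d: "int n dvd int (count M (2 * n)) - int (count M (2 * n + 1))"
    using M n by (auto simp: balanced_def)
  have "A_atom n \<subseteq># M \<or> B_atom n \<subseteq># M \<or> W_atom n \<subseteq># M"
  proof (cases "count M (2 * n) > 0 \<and> count M (2 * n + 1) > 0")
    case True
    then have "W_atom n \<subseteq># M"
      by (auto simp: W_atom_def subseteq_mset_def)
    then show ?thesis by blast
  next
    case False
    show ?thesis
    proof (cases "count M (2 * n) > 0")
      case True
      with False have "count M (2 * n + 1) = 0"
        by linarith
      with d have "int n dvd int (count M (2 * n))"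
        by (simp only: of_nat_0 diff_0_right)
      then have "n dvd count M (2 * n)"
        by (simp only: int_dvd_int_iff)
      then have "n \<le> count M (2 * n)"
        using True by (rule dvd_imp_le)
      then show ?thesis
        by (simp add: A_atom_def count_le_replicate_mset_subset_eq)
    next
      case neq: False
      with n have pos: "count M (2 * n + 1) > 0" and "count M (2 * n) = 0"
        by linarith+
      with d have "int n dvd int (count M (2 * n + 1))"
        by (simp only: of_nat_0 diff_0 dvd_minus_iff)
      then have "n dvd count M (2 * n + 1)"
        by (simp only: int_dvd_int_iff)
      then have "n \<le> count M (2 * n + 1)"
        using pos by (rule dvd_imp_le)
      then show ?thesis
        by (simp add: B_atom_def count_le_replicate_mset_subset_eq)
    qed
  qed
  then show ?thesis
    using n(1) by (auto simp: exchange_atoms_def)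
qed

lemma finitely_generated_balanced: "finitely_generated_monoid (multiset_monoid (balanced C))"
  unfolding finitely_generated_monoid_def
proof (intro exI[of _ exchange_atoms] conjI)
  show "exchange_atoms \<subseteq> carrier (multiset_monoid (balanced C))"
    using exchange_atoms_subset by simp
  show "finite exchange_atoms"
    using finite_C by (simp add: exchange_atoms_def)
  have "a \<in> S" if S: "submonoid S (multiset_monoid (balanced C))" "exchange_atoms \<subseteq> S"
    and "a \<in> balanced C" for S a
    using that(3)
  proof (induction "size a" arbitrary: a rule: less_induct)
    case less
    show ?case
    proof (cases "a = {#}")
      case True
      then show ?thesis using submonoid.one_closed[OF S(1)] by simp
    next
      case False
      then obtain u where u: "u \<in> exchange_atoms" "u \<subseteq># a"
        using exchange_atom_below less.prems by blast
      then have "u \<noteq> {#}"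
        using empty_notin_exchange_atoms by blast
      then have "size (a - u) < size a"
        using u(2) False by (simp add: size_Diff_submset nonempty_has_size)
      then have "a - u \<in> S"
        using less u exchange_atoms_subset balanced_diff by blast
      then have "u + (a - u) \<in> S"
        using submonoid.m_closed[OF S(1), of u "a - u"] u S(2) by auto
      then show ?thesis using u(2) by simp
    qed
  qed
  moreover have "submonoid (balanced C) (multiset_monoid (balanced C))"
    by unfold_locales (auto simp: balanced.empty_mem balanced.add_mem)
  ultimately show "carrier (multiset_monoid (balanced C)) =
      \<Inter> {S. submonoid S (multiset_monoid (balanced C)) \<and> exchange_atoms \<subseteq> S}"
    using exchange_atoms_subset by auto
qed

lemma count_exchange_atom:
  assumes "n \<in> C" "u \<in> exchange_atoms"
  shows "count u (2 * n) = (if u = A_atom n then n else 0) + (if u = W_atom n then 1 else 0)"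
    and "count u (2 * n + 1) = (if u = B_atom n then n else 0) + (if u = W_atom n then 1 else 0)"
  using assms ge_2[OF assms(1)]
  by (auto simp: exchange_atoms_def count_A_atom count_B_atom count_W_atom)

lemma exchange_atom_antichain:
  assumes "u \<in> exchange_atoms" "v \<in> exchange_atoms" "u \<subseteq># v"
  shows "u = v"
proof -
  obtain m n where "m \<in> C" "n \<in> C" "u \<in> {A_atom m, B_atom m, W_atom m}" "v \<in> {A_atom n, B_atom n, W_atom n}"
    using assms by (auto simp: exchange_atoms_def)
  then show ?thesis
    using mset_subset_eq_count[OF assms(3), of "2 * m"] mset_subset_eq_count[OF assms(3), of "2 * m + 1"]
      ge_2[of m] ge_2[of n]
    by (auto simp: count_A_atom count_B_atom count_W_atom split: if_splits)
qed

text \<open>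
  Every nonempty member has some \<open>v \<in> exchange_atoms\<close> below it. An irreducible one is equal to this
  \<open>v\<close>. Conversely, a nonempty factor of an element of the antichain has such a \<open>v\<close> below it,
  which can only be the whole element.
\<close>

lemma atoms_balanced:
  "atoms (reduced_monoid (multiset_monoid (balanced C))) = (\<lambda>u. {u}) ` exchange_atoms"
proof -
  have "u \<in> exchange_atoms" if u: "u \<in> balanced C" "u \<noteq> {#}"
    "\<forall>b\<in>balanced C. \<forall>c\<in>balanced C. u = b + c \<longrightarrow> b = {#} \<or> c = {#}" for u
  proof -
    obtain v where v: "v \<in> exchange_atoms" "v \<subseteq># u"
      using exchange_atom_below u(1,2) by blast
    then have "u = v + (u - v)" "v \<in> balanced C" "u - v \<in> balanced C" "v \<noteq> {#}"
      using exchange_atoms_subset balanced_diff u(1) empty_notin_exchange_atoms by auto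
    with u(3) have "u = v" by (metis add.right_neutral)
    with v show ?thesis by simp
  qed
  moreover have "b = {#} \<or> c = {#}"
    if bc: "b \<in> balanced C" "c \<in> balanced C" "b + c \<in> exchange_atoms" for b c
  proof (cases "b = {#}")
    case False
    then obtain v where v: "v \<in> exchange_atoms" "v \<subseteq># b"
      using exchange_atom_below bc by blast
    then have "v = b + c"
      using bc exchange_atom_antichain by (meson mset_subset_eq_add_left subset_mset.order_trans)
    with v(2) show ?thesis by simp
  qed simp
  ultimately show ?thesis
    unfolding balanced.atoms_reduced using exchange_atoms_subset empty_notin_exchange_atoms by blast
qed

text \<open>
  For fixed \<open>a\<close> these two equations determine, for each \<open>n\<close>, the possible multiplicities of the
  three atoms up to one parameter. They are the source of all lower bounds on distances.
\<close>

lemma count_factorizations: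
  assumes "n \<in> C" "z \<in> factorizations (multiset_monoid (balanced C)) a"
  shows "count a (2 * n) = n * count z {A_atom n} + count z {W_atom n}"
    and "count a (2 * n + 1) = n * count z {B_atom n} + count z {W_atom n}"
proof -
  have a: "a = (\<Sum>x\<in>#z. the_elem x)" and z: "set_mset z \<subseteq> (\<lambda>u. {u}) ` exchange_atoms"
    using assms by (auto simp: balanced.mem_factorizations_iff atoms_balanced)
  have "count (\<Sum>x\<in>#z. the_elem x) (2 * n) = n * count z {A_atom n} + count z {W_atom n} \<and>
    count (\<Sum>x\<in>#z. the_elem x) (2 * n + 1) = n * count z {B_atom n} + count z {W_atom n}"
    using z
  proof (induction z)
    case (add x z)
    then obtain u where "x = {u}" "u \<in> exchange_atoms" by auto
    then show ?case
      using add count_exchange_atom[OF assms(1), of u] by auto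
  qed simp
  then show "count a (2 * n) = n * count z {A_atom n} + count z {W_atom n}"
    and "count a (2 * n + 1) = n * count z {B_atom n} + count z {W_atom n}"
    by (simp_all add: a)
qed

lemma factorizations_exchange:
  assumes "n \<in> C"
  shows "g + {#{A_atom n}, {B_atom n}#} \<in> factorizations (multiset_monoid (balanced C)) a \<longleftrightarrow>
    g + replicate_mset n {W_atom n} \<in> factorizations (multiset_monoid (balanced C)) a"
proof -
  have "A_atom n + B_atom n = (\<Sum>x\<in>#replicate_mset n {W_atom n}. the_elem x)"
  proof -
    have "(\<Sum>x\<in>#replicate_mset k {W_atom n}. the_elem x) = repeat_mset k (W_atom n)" for k
      by (induction k) auto
    then show ?thesis
      by (auto intro: multiset_eqI simp: count_A_atom count_B_atom count_W_atom)
  qed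
  then show ?thesis
    using assms ge_2[OF assms]
    by (auto simp: balanced.mem_factorizations_iff atoms_balanced exchange_atoms_def ac_simps split: if_splits)
qed

text \<open>
  The multiplicity of \<open>W_atom n\<close> is determined modulo \<open>n\<close> by the element \<open>a\<close>. If \<open>u\<close> is \<open>W_atom n\<close>,
  it is absent from \<open>z\<close> and hence occurs at least \<open>n\<close> times in \<open>z'\<close>; moreover both other atoms
  occur in \<open>z\<close> and can be exchanged for \<open>n\<close> copies of \<open>W_atom n\<close>. If \<open>u\<close> is one of the other
  atoms, each copy of it in \<open>z'\<close> costs \<open>n\<close> copies of \<open>W_atom n\<close>, which must be present in \<open>z\<close> and
  can be exchanged there. As \<open>n \<ge> 2\<close>, such an exchange has distance \<open>max 2 n = n\<close>.
\<close>

lemma exchange_step: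
  assumes n: "n \<in> C"
    and u: "u \<in> {{A_atom n}, {B_atom n}, {W_atom n}}"
    and z: "z \<in> factorizations (multiset_monoid (balanced C)) a" "u \<notin># z"
    and z': "z' \<in> factorizations (multiset_monoid (balanced C)) a" "u \<in># z'"
  shows "n \<le> factorization_dist z z'"
    and "\<exists>y\<in>factorizations_with (multiset_monoid (balanced C)) a u. factorization_dist z y \<le> n"
proof -
  let ?X = "{#{A_atom n}, {B_atom n}#}" and ?Y = "replicate_mset n {W_atom n}"
  have n2: "2 \<le> n"
    using ge_2 n .
  note eqs = count_factorizations[OF n z(1)] count_factorizations[OF n z'(1)]
  have disj: "?X \<inter># ?Y = {#}" "?Y \<inter># ?X = {#}"
    by (auto simp: disjunct_not_in)
  have "n \<le> factorization_dist z z' \<and>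
    (\<exists>y\<in>factorizations_with (multiset_monoid (balanced C)) a u. factorization_dist z y \<le> n)"
  proof (cases "u = {W_atom n}")
    case True
    then have k: "count z {W_atom n} = 0" "count z' {W_atom n} > 0"
      using z(2) z'(2) by (auto simp: not_in_iff)
    have "n * count z {A_atom n} = n * count z' {A_atom n} + count z' {W_atom n}"
      and "n * count z {B_atom n} = n * count z' {B_atom n} + count z' {W_atom n}"
      using eqs k by simp_all
    then have "n dvd count z' {W_atom n}"
      by (metis dvd_add_right_iff dvd_triv_left)
    then have "n \<le> count z' {W_atom n}"
      using k by (auto intro: dvd_imp_le)
    then have lower: "n \<le> factorization_dist z z'"
      using k(1) count_le_factorization_dist(2)[of z' "{W_atom n}" z] by simp
    have "count z {A_atom n} > 0" "count z {B_atom n} > 0"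
      using eqs k by (force simp del: count_greater_zero_iff intro: Nat.gr0I)+
    then have "?X \<subseteq># z"
      using n2 by (auto simp: subseteq_mset_def)
    then obtain g where g: "z = g + ?X"
      by (metis add.commute subset_mset.le_iff_add)
    have "g + ?Y \<in> factorizations_with (multiset_monoid (balanced C)) a u"
      using z(1) factorizations_exchange[OF n, of g a] n2 True
      by (auto simp: mem_factorizations_with_iff g)
    moreover have "factorization_dist z (g + ?Y) \<le> n"
      unfolding g factorization_dist_exchange[OF disj(1)] using n2 by simp
    ultimately show ?thesis using lower by blast
  next
    case False
    then have "count z {A_atom n} = 0 \<and> count z' {A_atom n} > 0 \<or>
        count z {B_atom n} = 0 \<and> count z' {B_atom n} > 0"
      using u z(2) z'(2) by (auto simp: not_in_iff)
    then have k: "count z' {W_atom n} + n \<le> count z {W_atom n}"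
    proof (elim disjE conjE)
      assume "count z {A_atom n} = 0" "count z' {A_atom n} > 0"
      then show ?thesis using eqs(1,3) by (cases "count z' {A_atom n}") auto
    next
      assume "count z {B_atom n} = 0" "count z' {B_atom n} > 0"
      then show ?thesis using eqs(2,4) by (cases "count z' {B_atom n}") auto
    qed
    then have lower: "n \<le> factorization_dist z z'"
      using count_le_factorization_dist(1)[of z "{W_atom n}" z'] by simp
    have "?Y \<subseteq># z"
      using k by (intro count_le_replicate_mset_subset_eq[THEN iffD1]) linarith
    then obtain g where g: "z = g + ?Y"
      by (metis add.commute subset_mset.le_iff_add)
    have "g + ?X \<in> factorizations_with (multiset_monoid (balanced C)) a u"
      using z(1) factorizations_exchange[OF n, of g a] u False
      by (auto simp: mem_factorizations_with_iff g)
    moreover have "factorization_dist z (g + ?X) \<le> n"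
      unfolding g factorization_dist_exchange[OF disj(2)] using n2 by simp
    ultimately show ?thesis using lower by blast
  qed
  then show "n \<le> factorization_dist z z'"
    and "\<exists>y\<in>factorizations_with (multiset_monoid (balanced C)) a u. factorization_dist z y \<le> n"
    by auto
qed

lemma tame_degree_exchange:
  fixes a :: "nat multiset"
  assumes "n \<in> C" "u \<in> {{A_atom n}, {B_atom n}, {W_atom n}}"
  defines "H \<equiv> multiset_monoid (balanced C)"
  shows "tame_degree H a u =
    (if (\<exists>z\<in>factorizations H a. u \<notin># z) \<and> factorizations_with H a u \<noteq> {} then enat n else 0)"
  unfolding H_def
  by (rule tame_degree_eq)
    (use exchange_step[OF assms(1,2)] mem_factorizations_with_iff in metis)+

text \<open>
  The degree \<open>n\<close> is attained at \<open>A_atom n + B_atom n\<close>, whose factorization into copies of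
  \<open>W_atom n\<close> avoids \<open>A_atom n\<close>.
\<close>

lemma tame_degrees_balanced: "tame_degrees (multiset_monoid (balanced C)) = enat ` C"
proof (intro equalityI subsetI)
  let ?H = "multiset_monoid (balanced C)"
  fix t
  assume "t \<in> tame_degrees ?H"
  then obtain a u where t: "t = tame_degree ?H a u" "t > 0"
    and "u \<in> atoms (reduced_monoid ?H)"
    by (auto simp: tame_degrees_def)
  then obtain n where n: "n \<in> C" "u \<in> {{A_atom n}, {B_atom n}, {W_atom n}}"
    by (auto simp: atoms_balanced exchange_atoms_def)
  with t n(1) show "t \<in> enat ` C"
    using tame_degree_exchange[OF n, of a] by (auto split: if_splits)
next
  let ?H = "multiset_monoid (balanced C)"
  fix t
  assume "t \<in> enat ` C"
  then obtain n where n: "n \<in> C" "t = enat n" by auto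
  let ?a = "A_atom n + B_atom n" and ?u = "{A_atom n}"
  have z': "{#{A_atom n}, {B_atom n}#} \<in> factorizations ?H ?a"
    using n by (auto simp: balanced.mem_factorizations_iff atoms_balanced exchange_atoms_def)
  then have z: "replicate_mset n {W_atom n} \<in> factorizations ?H ?a"
    using factorizations_exchange[OF n(1), of "{#}"] by simp
  have "?u \<notin># replicate_mset n {W_atom n}" "{#{A_atom n}, {B_atom n}#} \<in> factorizations_with ?H ?a ?u"
    using z' by (auto simp: mem_factorizations_with_iff)
  with z have "tame_degree ?H ?a ?u = enat n"
    using tame_degree_exchange[OF n(1), of ?u ?a] by auto
  moreover have "?a \<in> balanced C" "?u \<in> atoms (reduced_monoid ?H)"
    using n(1) exchange_atoms_subset
    by (auto simp: atoms_balanced exchange_atoms_def intro!: balanced.add_mem)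
  moreover have "enat n > 0"
    using ge_2[OF n(1)] by (simp add: zero_enat_def)
  ultimately show "t \<in> tame_degrees ?H"
    unfolding tame_degrees_def n(2)
    by (intro CollectI exI[of _ ?a] exI[of _ ?u]) simp
qed

end

theorem proposition5p5:
  fixes C :: "nat set"
  assumes "finite C" and "C \<noteq> {}" and "C \<subseteq> {2..}"
  shows "\<exists>H :: nat multiset monoid.
           krull_monoid H \<and> finitely_generated_monoid H \<and>
           has_finite_class_group H \<and> tame_degrees H = enat ` C"
  using krull_monoid_balanced[OF assms(1,3)] finitely_generated_balanced[OF assms(1,3)]
    has_finite_class_group_balanced[OF assms(1,3)] tame_degrees_balanced[OF assms(1,3)]
  by blast

end
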